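(* Let $D$ be a division algebra of finite dimension $m>1$ over its center $F$, let $v_1,\dots,v_m$ be an $F$-linear basis of $D$, let $n\ge 1$, and let $b_{st}^{j}\in F$ ($1\le j,s,t\le m$) be the unique elements such that for every $x=\sum_{j=1}^m c_jv_j\in D$ (with $c_j\in F$) one has $c_j=\sum_{s=1}^m\sum_{t=1}^m b_{st}^{j}v_sxv_t$ for all $1\le j\le m$. Let $A=D_F\langle x_1,\dots,x_n\rangle$ be the algebra of formal non-commutative polynomials over $D$, and for $1\le i\le n$, $1\le j\le m$ let $$Y_{ij}=\sum_{s=1}^m\sum_{t=1}^m b_{st}^{j}\,v_s x_i v_t\in A .$$ Then the ideal of generalized polynomial identities $\mathrm{GPI}(D,n)=\ker\big(A\to D[x_1,\dots,x_n]\big)$ is generated, as a two-sided ideal of $A$, by the following elements: - $v_kY_{ij}-Y_{ij}v_k$ for $1\le i\le n$, $1\le j,k\le m$; - $Y_{ij}Y_{i'j'}-Y_{i'j'}Y_{ij}$ for $1\le i,i'\le n$, $1\le j,j'\le m$; - $x_i-\sum_{j=1}^m Y_{ij}v_j$ for $1\le i\le n$.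
   Context: $A=D_F\langle x_1,\dots,x_n\rangle:=D*_F F\langle x_1,\dots,x_n\rangle$ is the coproduct (free product) over $F$ of $D$ and the free associative $F$-algebra on $x_1,\dots,x_n$. Each element of $A$ is a finite sum of terms $a_1x_{\mu_1}a_2x_{\mu_2}\cdots a_kx_{\mu_k}a_{k+1}$ with $k\ge0$, $a_p\in D$, $\mu_p\in\{1,\dots,n\}$, and the scalars in $F$ are central in $A$. $D[x_1,\dots,x_n]$ denotes the ring of polynomial functions over $D$: all functions $f:D^n\to D$ expressible as finite sums of terms $a_1x_{\mu_1}a_2x_{\mu_2}\cdots a_kx_{\mu_k}a_{k+1}$ with $a_p\in D$, with pointwise addition and multiplication. The canonical homomorphism $A\to D[x_1,\dots,x_n]$ sends a formal polynomial to the function it defines; its kernel $\mathrm{GPI}(D,n)$ is the ideal of generalized polynomial identities in $n$ variables over $D$. All ideals are two-sided. The existence and uniqueness of the constants $b_{st}^j$ is a known fact that may be taken as part of the setting. *)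

theory Defs
  imports Main "HOL.Vector_Spaces" "HOL.Hull"
begin

typedef (overloaded) 'd center = "{c :: 'd::division_ring. \<forall>x. c * x = x * c}"
  morphisms of_center to_center
  by (rule exI[of _ 0]) simp

setup_lifting type_definition_center

lemma of_center_commute: "of_center c * x = x * of_center c"
  using of_center[of c] by blast

lemma center_mult_closed:
  fixes a b :: "'d::division_ring"
  assumes a: "\<And>x. a * x = x * a" and b: "\<And>x. b * x = x * b"
  shows "a * b * x = x * (a * b)"
proof -
  have "a * b * x = a * (b * x)" by (rule mult.assoc)
  also have "\<dots> = a * (x * b)" using b by (simp only:)
  also have "\<dots> = (a * x) * b" by (simp add: mult.assoc)
  also have "\<dots> = (x * a) * b" using a by (simp only:)
  also have "\<dots> = x * (a * b)" by (simp add: mult.assoc)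
  finally show "a * b * x = x * (a * b)" .
qed

instantiation center :: (division_ring) field
begin

lift_definition zero_center :: "'a center" is 0 by simp
lift_definition one_center :: "'a center" is 1 by simp
lift_definition plus_center :: "'a center \<Rightarrow> 'a center \<Rightarrow> 'a center" is "(+)"
  by (simp add: algebra_simps)
lift_definition minus_center :: "'a center \<Rightarrow> 'a center \<Rightarrow> 'a center" is "(-)"
  by (simp add: algebra_simps)
lift_definition uminus_center :: "'a center \<Rightarrow> 'a center" is uminus
  by simp
lift_definition times_center :: "'a center \<Rightarrow> 'a center \<Rightarrow> 'a center" is "(*)"
  by (rule center_mult_closed)
lift_definition inverse_center :: "'a center \<Rightarrow> 'a center" is inverse
  by (simp add: mult_commute_imp_mult_inverse_commute)
definition divide_center :: "'a center \<Rightarrow> 'a center \<Rightarrow> 'a center" where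
  "divide_center a b = a * inverse b"

instance
proof
  fix a b c :: "'a center"
  show "a * b * c = a * (b * c)" by transfer (rule mult.assoc)
  show "a * b = b * a" by transfer blast
  show "1 * a = a" by transfer (rule mult_1_left)
  show "a + b + c = a + (b + c)" by transfer (simp add: add.assoc)
  show "a + b = b + a" by transfer (simp add: add.commute)
  show "0 + a = a" by transfer simp
  show "- a + a = 0" by transfer simp
  show "a - b = a + - b" by transfer simp
  show "(a + b) * c = a * c + b * c" by transfer (rule distrib_right)
  show "(0 :: 'a center) \<noteq> 1" by transfer simp
  show "a \<noteq> 0 \<Longrightarrow> inverse a * a = 1" by transfer (rule left_inverse)
  show "a div b = a * inverse b" by (rule divide_center_def)
  show "inverse (0 :: 'a center) = 0" by transfer simp
qed

end

definition center_scale :: "'d center \<Rightarrow> 'd \<Rightarrow> 'd::division_ring" where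
  "center_scale c x = of_center c * x"

global_interpretation center: vector_space center_scale
  by unfold_locales
     (simp_all add: center_scale_def distrib_left distrib_right mult.assoc
        plus_center.rep_eq times_center.rep_eq one_center.rep_eq)

text \<open>
  The coproduct over the center \<open>F\<close> of \<open>'d\<close> and the free associative \<open>F\<close>-algebra on the
  variables \<open>'n\<close> is presented by generators (the elements of \<open>'d\<close> and the variables) and
  relations. Its universal property is \<open>gpoly_universal\<close> below; a homomorphism out of the free
  algebra is represented there by the images of the variables.
\<close>

datatype ('d, 'n) gterm =
    Const 'd
  | Var 'n
  | Plus "('d, 'n) gterm" "('d, 'n) gterm"
  | Neg "('d, 'n) gterm"
  | Times "('d, 'n) gterm" "('d, 'n) gterm"

inductive gterm_eq :: "('d::division_ring, 'n) gterm \<Rightarrow> ('d, 'n) gterm \<Rightarrow> bool" where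
  refl: "gterm_eq p p"
| sym: "gterm_eq p q \<Longrightarrow> gterm_eq q p"
| trans: "gterm_eq p q \<Longrightarrow> gterm_eq q r \<Longrightarrow> gterm_eq p r"
| Plus_cong: "gterm_eq p p' \<Longrightarrow> gterm_eq q q' \<Longrightarrow> gterm_eq (Plus p q) (Plus p' q')"
| Neg_cong: "gterm_eq p p' \<Longrightarrow> gterm_eq (Neg p) (Neg p')"
| Times_cong: "gterm_eq p p' \<Longrightarrow> gterm_eq q q' \<Longrightarrow> gterm_eq (Times p q) (Times p' q')"
| Plus_assoc: "gterm_eq (Plus (Plus p q) r) (Plus p (Plus q r))"
| Plus_comm: "gterm_eq (Plus p q) (Plus q p)"
| Plus_zero: "gterm_eq (Plus (Const 0) p) p"
| Plus_Neg: "gterm_eq (Plus (Neg p) p) (Const 0)"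
| Times_assoc: "gterm_eq (Times (Times p q) r) (Times p (Times q r))"
| Times_one_left: "gterm_eq (Times (Const 1) p) p"
| Times_one_right: "gterm_eq (Times p (Const 1)) p"
| distrib_right: "gterm_eq (Times (Plus p q) r) (Plus (Times p r) (Times q r))"
| distrib_left: "gterm_eq (Times p (Plus q r)) (Plus (Times p q) (Times p r))"
| Const_add: "gterm_eq (Const (a + b)) (Plus (Const a) (Const b))"
| Const_mult: "gterm_eq (Const (a * b)) (Times (Const a) (Const b))"
| scalar_central: "gterm_eq (Times (Const (of_center c)) p) (Times p (Const (of_center c)))"

quotient_type (overloaded) ('d, 'n) gpoly = "('d::division_ring, 'n) gterm" / gterm_eq
  by (intro equivpI reflpI sympI transpI)
     (rule gterm_eq.refl, erule gterm_eq.sym, erule (1) gterm_eq.trans)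

primrec gterm_fold :: "('d \<Rightarrow> 'r::ring_1) \<Rightarrow> ('n \<Rightarrow> 'r) \<Rightarrow> ('d, 'n) gterm \<Rightarrow> 'r" where
  "gterm_fold \<phi> y (Const a) = \<phi> a"
| "gterm_fold \<phi> y (Var i) = y i"
| "gterm_fold \<phi> y (Plus p q) = gterm_fold \<phi> y p + gterm_fold \<phi> y q"
| "gterm_fold \<phi> y (Neg p) = - gterm_fold \<phi> y p"
| "gterm_fold \<phi> y (Times p q) = gterm_fold \<phi> y p * gterm_fold \<phi> y q"

definition unital_ring_hom :: "('a::ring_1 \<Rightarrow> 'b::ring_1) \<Rightarrow> bool" where
  "unital_ring_hom h \<longleftrightarrow>
     h 1 = 1 \<and> (\<forall>a b. h (a + b) = h a + h b) \<and> (\<forall>a b. h (a * b) = h a * h b)"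

lemma unital_ring_hom_zero: "unital_ring_hom h \<Longrightarrow> h 0 = 0"
  unfolding unital_ring_hom_def by (metis add_cancel_right_right)

lemma unital_ring_hom_uminus: "unital_ring_hom h \<Longrightarrow> h (- a) = - h a"
  using unital_ring_hom_zero[of h] unfolding unital_ring_hom_def
  by (metis add.right_inverse add_eq_0_iff)

lemma gterm_fold_scalar_central:
  assumes \<phi>: "unital_ring_hom \<phi>"
    and y: "\<And>c i. \<phi> (of_center c) * y i = y i * \<phi> (of_center c)"
  shows "\<phi> (of_center c) * gterm_fold \<phi> y p = gterm_fold \<phi> y p * \<phi> (of_center c)"
proof (induction p)
  case (Const a)
  show ?case
    using \<phi> of_center_commute[of c a] unfolding unital_ring_hom_def by (metis gterm_fold.simps(1))
next
  case (Times p q)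
  then show ?case by simp (metis mult.assoc)
qed (simp_all add: y algebra_simps)

lemma gterm_fold_cong:
  assumes \<phi>: "unital_ring_hom \<phi>"
    and y: "\<And>c i. \<phi> (of_center c) * y i = y i * \<phi> (of_center c)"
    and "gterm_eq p q"
  shows "gterm_fold \<phi> y p = gterm_fold \<phi> y q"
  using assms(3)
proof induction
  case (scalar_central c p)
  then show ?case using gterm_fold_scalar_central[OF \<phi> y] by simp
qed (use \<phi> unital_ring_hom_zero[OF \<phi>] in
      \<open>auto simp: unital_ring_hom_def algebra_simps\<close>)

instantiation gpoly :: (division_ring, type) ring_1
begin

lift_definition zero_gpoly :: "('a, 'b) gpoly" is "Const 0" .
lift_definition one_gpoly :: "('a, 'b) gpoly" is "Const 1" .
lift_definition plus_gpoly :: "('a, 'b) gpoly \<Rightarrow> ('a, 'b) gpoly \<Rightarrow> ('a, 'b) gpoly" is Plus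
  by (rule gterm_eq.Plus_cong)
lift_definition uminus_gpoly :: "('a, 'b) gpoly \<Rightarrow> ('a, 'b) gpoly" is Neg
  by (rule gterm_eq.Neg_cong)
lift_definition minus_gpoly :: "('a, 'b) gpoly \<Rightarrow> ('a, 'b) gpoly \<Rightarrow> ('a, 'b) gpoly"
  is "\<lambda>p q. Plus p (Neg q)"
  by (intro gterm_eq.Plus_cong gterm_eq.Neg_cong)
lift_definition times_gpoly :: "('a, 'b) gpoly \<Rightarrow> ('a, 'b) gpoly \<Rightarrow> ('a, 'b) gpoly" is Times
  by (rule gterm_eq.Times_cong)

instance
proof
  fix p q r :: "('a, 'b) gpoly"
  show "p * q * r = p * (q * r)" by transfer (rule gterm_eq.Times_assoc)
  show "1 * p = p" by transfer (rule gterm_eq.Times_one_left)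
  show "p * 1 = p" by transfer (rule gterm_eq.Times_one_right)
  show "p + q + r = p + (q + r)" by transfer (rule gterm_eq.Plus_assoc)
  show "p + q = q + p" by transfer (rule gterm_eq.Plus_comm)
  show "0 + p = p" by transfer (rule gterm_eq.Plus_zero)
  show "- p + p = 0" by transfer (rule gterm_eq.Plus_Neg)
  show "p - q = p + - q" by transfer (rule gterm_eq.refl)
  show "(p + q) * r = p * r + q * r" by transfer (rule gterm_eq.distrib_right)
  show "p * (q + r) = p * q + p * r" by transfer (rule gterm_eq.distrib_left)
  show "(0 :: ('a, 'b) gpoly) \<noteq> 1"
  proof transfer
    have "unital_ring_hom (\<lambda>a :: 'a. a)" by (simp add: unital_ring_hom_def)
    then show "\<not> gterm_eq (Const 0 :: ('a, 'b) gterm) (Const 1)"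
      using gterm_fold_cong[of "\<lambda>a :: 'a. a" "\<lambda>_. 0" "Const 0" "Const 1"] by auto
  qed
qed

end

lift_definition gp_const :: "'d \<Rightarrow> ('d::division_ring, 'n) gpoly" is Const .
lift_definition gp_var :: "'n \<Rightarrow> ('d::division_ring, 'n) gpoly" is Var .

lemma gp_const_hom: "unital_ring_hom (gp_const :: 'd \<Rightarrow> ('d::division_ring, 'n) gpoly)"
  unfolding unital_ring_hom_def
proof (intro conjI allI)
  show "gp_const 1 = (1 :: ('d, 'n) gpoly)" by transfer (rule gterm_eq.refl)
  show "gp_const (a + b) = (gp_const a + gp_const b :: ('d, 'n) gpoly)" for a b :: 'd
    by transfer (rule gterm_eq.Const_add)
  show "gp_const (a * b) = (gp_const a * gp_const b :: ('d, 'n) gpoly)" for a b :: 'd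
    by transfer (rule gterm_eq.Const_mult)
qed

lemma gp_const_central: "gp_const (of_center c) * p = p * gp_const (of_center c)"
proof -
  obtain t where p: "p = abs_gpoly t"
    by (induction p rule: gpoly.abs_induct) blast
  show ?thesis
    unfolding p gp_const.abs_eq times_gpoly.abs_eq gpoly.abs_eq_iff
    by (rule gterm_eq.scalar_central)
qed

lemma gpoly_induct [case_names const var plus uminus times]:
  assumes "\<And>a. P (gp_const a)" and "\<And>i. P (gp_var i)"
    and "\<And>p q. P p \<Longrightarrow> P q \<Longrightarrow> P (p + q)" and "\<And>p. P p \<Longrightarrow> P (- p)"
    and "\<And>p q. P p \<Longrightarrow> P q \<Longrightarrow> P (p * q)"
  shows "P (p :: ('d::division_ring, 'n) gpoly)"
proof -
  have "P (abs_gpoly t)" for t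
  proof (induction t)
    case (Const a)
    show ?case using assms(1)[of a] by (simp only: gp_const.abs_eq)
  next
    case (Var i)
    show ?case using assms(2)[of i] by (simp only: gp_var.abs_eq)
  next
    case (Plus s t)
    then show ?case using assms(3) by (simp only: plus_gpoly.abs_eq [symmetric])
  next
    case (Neg t)
    then show ?case using assms(4) by (simp only: uminus_gpoly.abs_eq [symmetric])
  next
    case (Times s t)
    then show ?case using assms(5) by (simp only: times_gpoly.abs_eq [symmetric])
  qed
  then show ?thesis by (rule gpoly.abs_induct)
qed

lemma gpoly_universal:
  fixes \<phi> :: "'d::division_ring \<Rightarrow> 'r::ring_1" and y :: "'n \<Rightarrow> 'r"
  assumes \<phi>: "unital_ring_hom \<phi>"
    and y: "\<And>c i. \<phi> (of_center c) * y i = y i * \<phi> (of_center c)"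
  shows "\<exists>!h. unital_ring_hom h \<and> (\<forall>a. h (gp_const a) = \<phi> a) \<and> (\<forall>i. h (gp_var i) = y i)"
proof (rule ex_ex1I)
  let ?h = "\<lambda>p. gterm_fold \<phi> y (rep_gpoly p)"
  have h: "?h (abs_gpoly t) = gterm_fold \<phi> y t" for t
    by (rule gterm_fold_cong[OF \<phi> y]) (rule gpoly.abs_eq_iff[THEN iffD1], rule Quotient3_abs_rep[OF Quotient3_gpoly])
  have "?h (p + q) = ?h p + ?h q \<and> ?h (p * q) = ?h p * ?h q" for p q
  proof -
    show ?thesis
      by (induction p rule: gpoly.abs_induct, induction q rule: gpoly.abs_induct)
         (simp add: plus_gpoly.abs_eq times_gpoly.abs_eq h)
  qed
  moreover have "?h 1 = 1"
    using \<phi> by (simp add: one_gpoly.abs_eq h unital_ring_hom_def)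
  ultimately show "\<exists>h. unital_ring_hom h \<and> (\<forall>a. h (gp_const a) = \<phi> a) \<and> (\<forall>i. h (gp_var i) = y i)"
    by (intro exI[of _ ?h]) (simp add: unital_ring_hom_def gp_const.abs_eq gp_var.abs_eq h)
next
  fix h k :: "('d, 'n) gpoly \<Rightarrow> 'r"
  assume h: "unital_ring_hom h \<and> (\<forall>a. h (gp_const a) = \<phi> a) \<and> (\<forall>i. h (gp_var i) = y i)"
    and k: "unital_ring_hom k \<and> (\<forall>a. k (gp_const a) = \<phi> a) \<and> (\<forall>i. k (gp_var i) = y i)"
  have "h p = k p" for p
    using h k unital_ring_hom_uminus[of h] unital_ring_hom_uminus[of k]
    by (induction p rule: gpoly_induct) (auto simp: unital_ring_hom_def)
  then show "h = k" ..
qed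

text \<open>
  The pair \<open>([(a\<^sub>1, i\<^sub>1), \<dots>, (a\<^sub>k, i\<^sub>k)], b)\<close> stands for the term
  \<open>a\<^sub>1 x\<^bsub>i\<^sub>1\<^esub> \<dots> a\<^sub>k x\<^bsub>i\<^sub>k\<^esub> b\<close>.
\<close>

primrec term_fun :: "('d \<times> 'n) list \<Rightarrow> 'd \<Rightarrow> ('n \<Rightarrow> 'd) \<Rightarrow> 'd::ring_1" where
  "term_fun [] b x = b"
| "term_fun (ai # w) b x = fst ai * x (snd ai) * term_fun w b x"

definition is_poly_fun :: "(('n \<Rightarrow> 'd) \<Rightarrow> 'd::ring_1) \<Rightarrow> bool" where
  "is_poly_fun f \<longleftrightarrow> (\<exists>ts. f = (\<lambda>x. \<Sum>(w, b)\<leftarrow>ts. term_fun w b x))"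

lemma is_poly_fun_term: "is_poly_fun (term_fun w b)"
  unfolding is_poly_fun_def by (rule exI[of _ "[(w, b)]"]) auto

lemma is_poly_fun_zero: "is_poly_fun (\<lambda>x. 0)"
  unfolding is_poly_fun_def by (rule exI[of _ "[]"]) simp

lemma is_poly_fun_const: "is_poly_fun (\<lambda>x :: 'n \<Rightarrow> 'd::ring_1. a)"
proof -
  have "term_fun [] a = (\<lambda>x :: 'n \<Rightarrow> 'd. a)" by (rule ext) simp
  then show ?thesis by (metis is_poly_fun_term)
qed

lemma is_poly_fun_var: "is_poly_fun (\<lambda>x :: 'n \<Rightarrow> 'd::ring_1. x i)"
proof -
  have "term_fun [(1, i)] 1 = (\<lambda>x :: 'n \<Rightarrow> 'd. x i)" by (rule ext) simp
  then show ?thesis by (metis is_poly_fun_term)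
qed

lemma is_poly_fun_add:
  assumes "is_poly_fun f" "is_poly_fun g"
  shows "is_poly_fun (\<lambda>x. f x + g x)"
proof -
  obtain ts us where "f = (\<lambda>x. \<Sum>(w, b)\<leftarrow>ts. term_fun w b x)"
    and "g = (\<lambda>x. \<Sum>(w, b)\<leftarrow>us. term_fun w b x)"
    using assms unfolding is_poly_fun_def by blast
  then show ?thesis unfolding is_poly_fun_def by (intro exI[of _ "ts @ us"]) simp
qed

lemma is_poly_fun_sum_list:
  "(\<And>t. t \<in> set ts \<Longrightarrow> is_poly_fun (f t)) \<Longrightarrow> is_poly_fun (\<lambda>x. \<Sum>t\<leftarrow>ts. f t x)"
  by (induction ts) (simp_all add: is_poly_fun_zero is_poly_fun_add)

lemma term_fun_mult_const: "\<exists>v c. \<forall>x. a * term_fun w b x = term_fun v c x"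
proof (cases w)
  case Nil
  then have "\<forall>x. a * term_fun w b x = term_fun [] (a * b) x" by simp
  then show ?thesis by blast
next
  case (Cons ai w')
  then have "\<forall>x. a * term_fun w b x = term_fun ((a * fst ai, snd ai) # w') b x"
    by (simp add: mult.assoc)
  then show ?thesis by blast
qed

lemma is_poly_fun_mult_term: "is_poly_fun (\<lambda>x. term_fun w b x * term_fun w' b' x)"
proof -
  obtain v c where v: "\<And>x. b * term_fun w' b' x = term_fun v c x"
    using term_fun_mult_const[of b w' b'] by blast
  have "term_fun w b x * term_fun w' b' x = term_fun (w @ v) c x" for x
    by (induction w) (simp_all add: v mult.assoc)
  then show ?thesis by (simp add: is_poly_fun_term)
qed

lemma is_poly_fun_mult:
  assumes "is_poly_fun f" "is_poly_fun g"
  shows "is_poly_fun (\<lambda>x. f x * g x)"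
proof -
  obtain ts us where fg: "f = (\<lambda>x. \<Sum>(w, b)\<leftarrow>ts. term_fun w b x)"
    "g = (\<lambda>x. \<Sum>(w, b)\<leftarrow>us. term_fun w b x)"
    using assms unfolding is_poly_fun_def by blast
  have "f x * g x = (\<Sum>t\<leftarrow>ts. \<Sum>u\<leftarrow>us. term_fun (fst t) (snd t) x * term_fun (fst u) (snd u) x)" for x
    unfolding fg case_prod_unfold by (simp add: sum_list_mult_const sum_list_const_mult)
  then show ?thesis
    by (simp add: is_poly_fun_sum_list is_poly_fun_mult_term)
qed

lemma is_poly_fun_uminus: "is_poly_fun f \<Longrightarrow> is_poly_fun (\<lambda>x. - f x)"
  using is_poly_fun_mult[OF is_poly_fun_const[of "- 1"], of f] by simp

typedef (overloaded) ('d, 'n) poly_fun = "{f :: ('n \<Rightarrow> 'd) \<Rightarrow> 'd::ring_1. is_poly_fun f}"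
  morphisms apply_poly_fun Abs_poly_fun
  using is_poly_fun_zero by blast

setup_lifting type_definition_poly_fun

instantiation poly_fun :: (ring_1, type) ring_1
begin

lift_definition zero_poly_fun :: "('a, 'b) poly_fun" is "\<lambda>x. 0"
  by (rule is_poly_fun_zero)
lift_definition one_poly_fun :: "('a, 'b) poly_fun" is "\<lambda>x. 1"
  by (rule is_poly_fun_const)
lift_definition plus_poly_fun :: "('a, 'b) poly_fun \<Rightarrow> ('a, 'b) poly_fun \<Rightarrow> ('a, 'b) poly_fun"
  is "\<lambda>f g x. f x + g x" by (rule is_poly_fun_add)
lift_definition uminus_poly_fun :: "('a, 'b) poly_fun \<Rightarrow> ('a, 'b) poly_fun"
  is "\<lambda>f x. - f x" by (rule is_poly_fun_uminus)
lift_definition minus_poly_fun :: "('a, 'b) poly_fun \<Rightarrow> ('a, 'b) poly_fun \<Rightarrow> ('a, 'b) poly_fun"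
  is "\<lambda>f g x. f x - g x"
  unfolding diff_conv_add_uminus by (intro is_poly_fun_add is_poly_fun_uminus)
lift_definition times_poly_fun :: "('a, 'b) poly_fun \<Rightarrow> ('a, 'b) poly_fun \<Rightarrow> ('a, 'b) poly_fun"
  is "\<lambda>f g x. f x * g x" by (rule is_poly_fun_mult)

instance
  by standard (transfer; simp add: algebra_simps fun_eq_iff)+

end

lift_definition pf_const :: "'d \<Rightarrow> ('d::ring_1, 'n) poly_fun" is "\<lambda>a x. a"
  by (rule is_poly_fun_const)
lift_definition pf_var :: "'n \<Rightarrow> ('d::ring_1, 'n) poly_fun" is "\<lambda>i x. x i"
  by (rule is_poly_fun_var)

lemma pf_const_hom: "unital_ring_hom pf_const"
  unfolding unital_ring_hom_def by (intro conjI allI; transfer) simp_all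

lemma pf_const_central: "pf_const (of_center c) * f = f * pf_const (of_center c)"
proof -
  have "\<forall>y. d * y = y * d \<Longrightarrow> pf_const d * f = f * pf_const d" for d
    by transfer simp
  then show ?thesis using of_center_commute by blast
qed

lift_definition canonical_hom :: "('d::division_ring, 'n) gpoly \<Rightarrow> ('d, 'n) poly_fun"
  is "gterm_fold pf_const pf_var"
  by (rule gterm_fold_cong[OF pf_const_hom pf_const_central])

lemma canonical_hom_const: "canonical_hom (gp_const a) = pf_const a"
  by (simp add: gp_const.abs_eq canonical_hom.abs_eq)

lemma canonical_hom_var: "canonical_hom (gp_var i) = pf_var i"
  by (simp add: gp_var.abs_eq canonical_hom.abs_eq)

lemma canonical_hom_hom: "unital_ring_hom canonical_hom"
  unfolding unital_ring_hom_def
proof (intro conjI allI)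
  show "canonical_hom 1 = 1"
    by (simp add: one_gpoly.abs_eq canonical_hom.abs_eq
        pf_const_hom[unfolded unital_ring_hom_def])
next
  fix p q :: "('a, 'b) gpoly"
  show "canonical_hom (p + q) = canonical_hom p + canonical_hom q"
    by (induction p rule: gpoly.abs_induct, induction q rule: gpoly.abs_induct)
       (simp add: plus_gpoly.abs_eq canonical_hom.abs_eq)
  show "canonical_hom (p * q) = canonical_hom p * canonical_hom q"
    by (induction p rule: gpoly.abs_induct, induction q rule: gpoly.abs_induct)
       (simp add: times_gpoly.abs_eq canonical_hom.abs_eq)
qed

definition GPI :: "('d::division_ring, 'n) gpoly set" where
  "GPI = {p. canonical_hom p = 0}"

definition two_sided_ideal :: "'a::ring_1 set \<Rightarrow> bool" where
  "two_sided_ideal I \<longleftrightarrow>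
     0 \<in> I \<and> (\<forall>a\<in>I. \<forall>b\<in>I. a + b \<in> I) \<and> (\<forall>a\<in>I. \<forall>r. r * a \<in> I \<and> a * r \<in> I)"

definition ideal_generated :: "'a::ring_1 set \<Rightarrow> 'a set" where
  "ideal_generated S = two_sided_ideal hull S"

end

theory Submission
  imports Defs "HOL-Library.FuncSet" "HOL-Computational_Algebra.Polynomial_Factorial"
    "HOL-Computational_Algebra.Fundamental_Theorem_Algebra"
begin

text \<open>
  Write \<open>D\<close> for the division algebra and \<open>F\<close> for its center. As a function, \<open>Y i j\<close> maps a point
  \<open>x\<close> to the \<open>j\<close>-th coordinate of \<open>x i\<close>, a central element. So the listed relations hold
  identically on \<open>D\<close>, and the ideal \<open>J\<close> they generate consists of identities. Conversely, modulo \<open>J\<close>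
  the \<open>Y i j\<close> are central (\<open>Y_central\<close>) and the variables can be expressed by them, so that every
  formal polynomial becomes a commutative polynomial in the \<open>Y i j\<close> with coefficients in \<open>D\<close>
  (\<open>all_polys\<close>). At a point of \<open>D^n\<close> the \<open>Y i j\<close> take arbitrary values in \<open>F\<close>, independently of
  one another. A commutative polynomial that vanishes for all values in an infinite field has zero
  coefficients, hence an identity is zero modulo \<open>J\<close>. In \<open>vanishing_in_ideal\<close> this argument removes
  the \<open>Y i j\<close> one at a time, which avoids a normal form in several variables: the statement that
  the coefficients are zero is replaced by the statement that they lie in \<open>J\<close>.

  The argument needs \<open>F\<close> to be infinite, and this is where noncommutativity enters. If \<open>F\<close> were
  finite, then \<open>D\<close> would be finite as well, hence commutative by Wedderburn's theorem
  (\<open>finite_division_ring_commute\<close>), and \<open>m > 1\<close> would fail. When \<open>D = F\<close> is a finite field of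
  order \<open>q\<close>, the analogous statement is false: the relations only make the variables commute,
  while \<open>x^q - x\<close> vanishes identically. Wedderburn's theorem is proved by the class equation, with
  the value \<open>\<Phi>\<^sub>n(q)\<close> of the cyclotomic polynomial replaced by the value of a prime factor of
  \<open>X^n - 1\<close> in \<open>\<int>[X]\<close> (\<open>cyclotomic_divisor\<close>).
\<close>

section \<open>A common divisor of the noncentral terms of the class equation\<close>

abbreviation poly_at :: "int poly \<Rightarrow> complex \<Rightarrow> complex" where
  "poly_at p z \<equiv> poly (map_poly of_int p) z"

lemma map_poly_of_int_mult:
  "map_poly of_int (p * q) = (map_poly of_int p * map_poly of_int q :: 'a::comm_ring_1 poly)"
  by (rule poly_eqI) (simp add: coeff_map_poly coeff_mult)

lemma poly_at_of_int: "poly_at p (of_int k) = of_int (poly p k)"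
  by (induction p) (simp_all add: map_poly_pCons)

text \<open>
  \<open>\<int>[X]\<close> is factorial and evaluation at \<open>z\<close> is multiplicative into a field, so one of the
  prime factors of \<open>p\<close> must vanish at \<open>z\<close>.
\<close>

lemma prime_factor_with_root:
  assumes "p \<noteq> 0" and "poly_at p z = 0"
  obtains P where "prime_elem P" "P dvd p" "poly_at P z = 0"
proof -
  have root: "\<exists>P\<in>#A. poly_at P z = 0" if "poly_at (prod_mset A) z = 0" for A
    using that by (induction A) (auto simp: map_poly_of_int_mult)
  have "poly_at (prod_mset (prime_factorization p)) z = 0"
  proof -
    have "p dvd prod_mset (prime_factorization p)"
      using prod_mset_prime_factorization_weak[OF assms(1)] by (simp add: associated_iff_dvd)
    with assms(2) show ?thesis
      by (auto simp: dvd_def map_poly_of_int_mult)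
  qed
  then obtain P where "P \<in># prime_factorization p" "poly_at P z = 0"
    using root by blast
  then show thesis
    by (intro that) (auto intro: prime_imp_prime_elem in_prime_factors_imp_prime)
qed

text \<open>
  \<open>\<bar>q - z\<bar>\<^sup>2 = q\<^sup>2 - 2 q Re z + 1\<close>, and \<open>Re z < 1\<close>.
\<close>

lemma norm_diff_root_of_unity:
  fixes z :: complex and q :: real
  assumes "q \<ge> 2" "norm z = 1" "z \<noteq> 1"
  shows "q - 1 < norm (of_real q - z)"
proof -
  have n1: "(Re z)\<^sup>2 + (Im z)\<^sup>2 = 1"
    using assms(2) by (simp add: cmod_power2[symmetric])
  have "Re z \<noteq> 1"
    using n1 assms(3) by (auto simp: complex_eq_iff)
  moreover have "Re z \<le> 1" using complex_Re_le_cmod[of z] assms(2) by simp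
  ultimately have "Re z < 1" by simp
  then have "q * Re z < q" using assms(1) by simp
  have "(norm (of_real q - z))\<^sup>2 = q\<^sup>2 - 2 * (q * Re z) + ((Re z)\<^sup>2 + (Im z)\<^sup>2)"
    unfolding cmod_power2 by (simp add: power2_eq_square algebra_simps)
  also have "\<dots> > (q - 1)\<^sup>2"
    using n1 \<open>q * Re z < q\<close> by (simp add: power2_eq_square algebra_simps)
  finally show ?thesis by (rule power2_less_imp_less) simp
qed

lemma norm_prod_mset_gt:
  fixes f :: "'a \<Rightarrow> real"
  assumes "1 \<le> c" "A \<noteq> {#}" "\<And>x. x \<in># A \<Longrightarrow> c < f x"
  shows "c < (\<Prod>x\<in>#A. f x)"
  using assms(2,3)
proof (induction A)
  case (add a A)
  have "1 \<le> (\<Prod>x\<in>#A. f x)"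
  proof (cases "A = {#}")
    case False
    then have "c < (\<Prod>x\<in>#A. f x)" using add by auto
    then show ?thesis using assms(1) by simp
  qed simp
  moreover have "c < f a" using add.prems by simp
  ultimately have "c * 1 < f a * (\<Prod>x\<in>#A. f x)"
    using assms(1) by (intro mult_less_le_imp_less) auto
  then show ?case by simp
qed simp

text \<open>
  The number \<open>N\<close> plays the part of the cyclotomic value \<open>\<Phi>\<^sub>n(q)\<close> in Witt's argument. Let
  \<open>\<zeta> = exp (2 \<pi> i / n)\<close> and let \<open>P\<close> be a prime factor of \<open>X^n - 1\<close> in \<open>\<int>[X]\<close> with \<open>P(\<zeta>) = 0\<close>; put \<open>N = P(q)\<close>. If \<open>n = d e\<close> with \<open>d < n\<close>, then \<open>P\<close> does not divide
  \<open>X^d - 1\<close>, since \<open>\<zeta>^d \<noteq> 1\<close>, so it divides the cofactor \<open>1 + X^d + \<dots> + X^(d (e - 1))\<close>. The case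
  \<open>d = 1\<close> shows that the complex roots of \<open>P\<close> are roots of unity other than \<open>1\<close>. Each of them
  is further from \<open>q\<close> than \<open>1\<close> is, so \<open>\<bar>P(q)\<bar>\<close>, a nonempty product of such distances times the
  leading coefficient, exceeds \<open>q - 1\<close>.
\<close>

lemma cyclotomic_divisor:
  fixes q n :: nat
  assumes q: "2 \<le> q" and n: "2 \<le> n"
  obtains N :: int where "int q - 1 < \<bar>N\<bar>" "N dvd int q ^ n - 1"
    "\<And>d e. n = d * e \<Longrightarrow> d < n \<Longrightarrow> N dvd (\<Sum>i<e. (int q ^ d) ^ i)"
proof -
  let ?X = "[:0, 1:] :: int poly"
  define z where "z = cis (2 * pi * real 1 / real n)"
  have inj: "inj_on (\<lambda>k. cis (2 * pi * real k / real n)) {..<n}"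
    using bij_betw_roots_unity[of n] n by (simp add: bij_betw_def)
  have zn: "z ^ n = 1"
    using n by (simp add: z_def DeMoivre)
  have zd: "z ^ d \<noteq> 1" if "0 < d" "d < n" for d
  proof
    assume "z ^ d = 1"
    then have "cis (2 * pi * real d / real n) = cis (2 * pi * real 0 / real n)"
      by (simp add: z_def DeMoivre mult_ac)
    then show False using inj_onD[OF inj, of d 0] that by simp
  qed
  have at_X: "poly_at (?X ^ k - 1) w = w ^ k - 1" for k w
  proof -
    have "map_poly of_int (?X ^ k) = ([:0, 1:] ^ k :: complex poly)"
      by (induction k) (simp_all add: map_poly_of_int_mult map_poly_pCons del: mult_pCons_left)
    moreover have "map_poly of_int (p - 1) = (map_poly of_int p - 1 :: complex poly)" for p :: "int poly"
      by (rule poly_eqI) (simp add: coeff_map_poly)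
    ultimately show ?thesis by simp
  qed
  have X_nonzero: "?X ^ n - 1 \<noteq> 0"
  proof
    assume "?X ^ n - 1 = 0"
    then have "poly (?X ^ n - 1) 0 = 0" by simp
    then show False using n by (simp add: power_0_left)
  qed
  obtain P where P: "prime_elem P" "P dvd ?X ^ n - 1" "poly_at P z = 0"
    using prime_factor_with_root[OF X_nonzero] zn at_X by (metis diff_self)
  have fact: "?X ^ n - 1 = (?X ^ d - 1) * (\<Sum>i<e. (?X ^ d) ^ i)" if "n = d * e" for d e
    using power_diff_1_eq[of "?X ^ d" e] that by (simp add: power_mult)
  have P_dvd: "P dvd (\<Sum>i<e. (?X ^ d) ^ i)" if "n = d * e" "d < n" for d e
  proof -
    have "\<not> P dvd ?X ^ d - 1"
    proof
      assume "P dvd ?X ^ d - 1"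
      then have "poly_at (?X ^ d - 1) z = 0"
        using P(3) by (auto simp: dvd_def map_poly_of_int_mult)
      moreover have "0 < d" using that n by (cases d) auto
      ultimately show False using zd that at_X by simp
    qed
    then show ?thesis
      using P(1,2) fact[OF that(1)] by (metis prime_elem_dvd_mult_iff)
  qed
  have roots: "norm w = 1 \<and> w \<noteq> 1" if w: "poly_at P w = 0" for w
  proof
    have "poly_at (?X ^ n - 1) w = 0"
      using P(2) w by (auto simp: dvd_def map_poly_of_int_mult)
    then have "w ^ n = 1" using at_X by simp
    then have "norm w ^ n = 1 ^ n" by (simp add: norm_power[symmetric])
    then show "norm w = 1"
      using n by (metis norm_ge_zero power_eq_imp_eq_base zero_le_one zero_less_numeral order_less_le_trans)
    have "P dvd (\<Sum>i<n. ?X ^ i)" using P_dvd[of 1 n] n by simp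
    then have "poly_at (\<Sum>i<n. ?X ^ i) w = 0"
      using w by (auto simp: dvd_def map_poly_of_int_mult)
    moreover have "poly_at (\<Sum>i<n. ?X ^ i) 1 = of_nat n"
    proof -
      have "poly_at (\<Sum>i<n. ?X ^ i) (of_int 1) = of_int (poly (\<Sum>i<n. ?X ^ i) 1)"
        by (rule poly_at_of_int)
      then show ?thesis by (simp add: poly_sum)
    qed
    ultimately show "w \<noteq> 1" using n by auto
  qed
  define Pc :: "complex poly" where "Pc = map_poly of_int P"
  have "P \<noteq> 0" using P(1) by auto
  then have Pc: "Pc \<noteq> 0" "lead_coeff Pc = of_int (lead_coeff P)"
    by (auto simp: Pc_def map_poly_eq_0_iff coeff_map_poly degree_map_poly)
  obtain A where A: "size A = degree Pc" "Pc = smult (lead_coeff Pc) (\<Prod>x\<in>#A. [:-x, 1:])"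
    using alg_closed_imp_factorization[OF Pc(1)] by blast
  have poly_A: "poly Pc w = lead_coeff Pc * (\<Prod>x\<in>#A. w - x)" for w
    by (subst A(2)) (simp add: poly_prod_mset image_mset.compositionality o_def)
  have A_roots: "norm x = 1 \<and> x \<noteq> 1" if "x \<in># A" for x
  proof -
    have "poly Pc x = 0" unfolding poly_A using that by (auto simp: prod_mset_zero_iff)
    then show ?thesis using roots by (simp add: Pc_def)
  qed
  have "A \<noteq> {#}"
    using P(3) poly_A[of z] Pc by (auto simp: Pc_def)
  have "int q - 1 < \<bar>poly P (int q)\<bar>"
  proof -
    have norm_prod: "norm (\<Prod>x\<in>#B. of_nat q - x) = (\<Prod>x\<in>#B. norm (of_nat q - x))"
      for B :: "complex multiset"
      by (induction B) (simp_all add: norm_mult)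
    have "real q - 1 < (\<Prod>x\<in>#A. norm (of_nat q - x))"
      using q \<open>A \<noteq> {#}\<close> A_roots norm_diff_root_of_unity[of "real q"]
      by (intro norm_prod_mset_gt) auto
    also have "\<dots> \<le> norm (lead_coeff Pc) * (\<Prod>x\<in>#A. norm (of_nat q - x))"
    proof -
      have "1 \<le> \<bar>lead_coeff P\<bar>" using \<open>P \<noteq> 0\<close> by (simp add: int_one_le_iff_zero_less)
      then have "1 \<le> norm (lead_coeff Pc)"
        unfolding Pc(2) norm_of_int by linarith
      then show ?thesis
        using calculation q mult_right_mono[of 1 "norm (lead_coeff Pc)" "\<Prod>x\<in>#A. norm (of_nat q - x)"]
        by simp
    qed
    also have "\<dots> = norm (poly Pc (of_int (int q)))"
      by (simp add: poly_A norm_mult norm_prod)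
    also have "\<dots> = real_of_int \<bar>poly P (int q)\<bar>"
      unfolding Pc_def poly_at_of_int by simp
    finally show ?thesis by linarith
  qed
  moreover have "poly P (int q) dvd int q ^ n - 1"
  proof -
    have "poly P (int q) dvd poly (?X ^ n - 1) (int q)"
      using P(2) by (metis dvd_def poly_mult)
    then show ?thesis by simp
  qed
  moreover have "poly P (int q) dvd (\<Sum>i<e. (int q ^ d) ^ i)" if "n = d * e" "d < n" for d e
  proof -
    have "poly P (int q) dvd poly (\<Sum>i<e. (?X ^ d) ^ i) (int q)"
      using P_dvd[OF that] by (metis dvd_def poly_mult)
    then show ?thesis by (simp add: poly_sum)
  qed
  ultimately show thesis by (rule that)
qed

text \<open>
  One step of the Euclidean algorithm: \<open>q^n - 1 = q^(n-d) (q^d - 1) + (q^(n-d) - 1)\<close>.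
\<close>

lemma power_minus_1_dvd_imp_dvd:
  fixes q :: nat
  assumes q: "2 \<le> q" and "0 < d" and dvd: "(q ^ d - 1) dvd (q ^ n - 1)"
  shows "d dvd n"
  using dvd
proof (induction n rule: less_induct)
  case (less n)
  show ?case
  proof (cases "d \<le> n")
    case False
    then have "q ^ n - 1 < q ^ d - 1"
      using q by (intro diff_less_mono) (auto intro: power_strict_increasing)
    then have "q ^ n - 1 = 0" using less.prems by (meson dvd_imp_le not_less neq0_conv)
    then have "n = 0" using q one_less_power[of q n] by (cases "n = 0") auto
    then show ?thesis by simp
  next
    case True
    have "q ^ n - 1 = q ^ (n - d) * (q ^ d - 1) + (q ^ (n - d) - 1)"
      using True q by (simp add: algebra_simps power_add[symmetric])
    then have "(q ^ d - 1) dvd (q ^ (n - d) - 1)"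
      using less.prems by (metis dvd_add_right_iff dvd_triv_right)
    then have "d dvd n - d"
      using less.IH[of "n - d"] True \<open>0 < d\<close> by simp
    then show ?thesis using True by (metis dvd_diffD dvd_refl)
  qed
qed

section \<open>Finite division rings are commutative\<close>

lemma finite_center:
  assumes "finite (UNIV :: 'd::division_ring set)"
  shows "finite (UNIV :: 'd center set)"
proof -
  have "inj (of_center :: 'd center \<Rightarrow> 'd)" by (simp add: inj_def of_center_inject)
  then show ?thesis using assms by (metis finite_imageD finite_subset subset_UNIV)
qed

lemma card_span_independent:
  fixes B :: "'d::division_ring set"
  assumes "finite (UNIV :: 'd set)" and "center.independent B"
  shows "card (center.span B) = card (UNIV :: 'd center set) ^ card B"
  using finite_subset[OF subset_UNIV assms(1), of B] assms(2)
proof (induction B)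
  case (insert a B)
  have ind: "center.independent B" and a: "a \<notin> center.span B"
    using insert.prems insert.hyps(2) by (simp_all add: center.independent_insert)
  let ?f = "\<lambda>(c, y). center_scale c a + y"
  have "inj_on ?f (UNIV \<times> center.span B)"
  proof (intro inj_onI, clarify)
    fix c y c' y'
    assume y: "y \<in> center.span B" "y' \<in> center.span B"
      and eq: "center_scale c a + y = center_scale c' a + y'"
    have "center_scale (c - c') a = y' - y"
      using eq by (simp add: center.scale_left_diff_distrib algebra_simps)
    then have *: "center_scale (c - c') a \<in> center.span B"
      using y by (simp add: center.span_diff)
    have "c = c'"
    proof (rule ccontr)
      assume "c \<noteq> c'"
      then have "a = center_scale (inverse (c - c')) (center_scale (c - c') a)" by simp
      then show False using a center.span_scale[OF *] by metis
    qed
    then show "c = c' \<and> y = y'" using eq by simp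
  qed
  moreover have "?f ` (UNIV \<times> center.span B) = center.span (insert a B)"
  proof (intro equalityI subsetI)
    fix x assume "x \<in> center.span (insert a B)"
    then obtain c where "x - center_scale c a \<in> center.span B"
      by (auto simp: center.span_insert)
    then show "x \<in> ?f ` (UNIV \<times> center.span B)"
      by (intro image_eqI[of _ _ "(c, x - center_scale c a)"]) auto
  next
    fix x assume "x \<in> ?f ` (UNIV \<times> center.span B)"
    then obtain c y where "x = center_scale c a + y" "y \<in> center.span B" by auto
    then have "x - center_scale c a \<in> center.span B" by simp
    then show "x \<in> center.span (insert a B)" by (auto simp: center.span_insert)
  qed
  ultimately have "card (center.span (insert a B)) = card ((UNIV :: 'd center set) \<times> center.span B)"
    by (metis card_image)
  then show ?case using insert ind by (simp add: card_cartesian_product)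
qed (simp add: center.span_empty)

lemma card_subspace:
  fixes S :: "'d::division_ring set"
  assumes "finite (UNIV :: 'd set)" and "center.subspace S"
  obtains k where "card S = card (UNIV :: 'd center set) ^ k"
proof -
  obtain B where B: "B \<subseteq> S" "center.independent B" "S \<subseteq> center.span B"
    using center.basis_exists by metis
  then have "center.span B = S" using assms(2) center.span_minimal by blast
  then show thesis using that card_span_independent[OF assms(1) B(2)] by simp
qed

lemma two_le_card_center:
  assumes "finite (UNIV :: 'd::division_ring set)"
  shows "2 \<le> card (UNIV :: 'd center set)"
proof -
  have "card {0, 1 :: 'd center} \<le> card (UNIV :: 'd center set)"
    by (rule card_mono) (auto intro: finite_center assms)
  then show ?thesis by simp
qed

definition centralizer :: "'a::ring_1 \<Rightarrow> 'a set" where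
  "centralizer a = {g. g * a = a * g}"

lemma subspace_centralizer: "center.subspace (centralizer (a :: 'd::division_ring))"
proof -
  have "of_center c * g * a = a * (of_center c * g)" if "g * a = a * g" for c g
  proof -
    have "of_center c * g * a = of_center c * a * g" using that by (simp add: mult.assoc)
    also have "\<dots> = a * (of_center c * g)" by (simp add: of_center_commute[of c a] mult.assoc)
    finally show ?thesis .
  qed
  then show ?thesis
    unfolding center.subspace_def centralizer_def center_scale_def
    by (simp add: semiring_class.distrib_left semiring_class.distrib_right)
qed

definition conjugates :: "'a::division_ring \<Rightarrow> 'a set" where
  "conjugates a = (\<lambda>g. g * a * inverse g) ` (- {0})"

text \<open>
  Orbit and stabilizer for the multiplicative group acting by conjugation: each fibre of
  \<open>g \<mapsto> g a inverse g\<close> is a coset of the group of nonzero elements of the centralizer.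
\<close>

lemma card_conjugates:
  fixes a :: "'d::division_ring"
  assumes fin: "finite (UNIV :: 'd set)"
  shows "card (conjugates a) * (card (centralizer a) - 1) = card (UNIV :: 'd set) - 1"
proof -
  let ?f = "\<lambda>g. g * a * inverse g"
  have fibre: "card {g \<in> - {0}. ?f g = y} = card (centralizer a) - 1" if y: "y \<in> conjugates a" for y
  proof -
    obtain h where h: "h \<noteq> 0" "y = h * a * inverse h"
      using y unfolding conjugates_def by blast
    have iff: "h * k * a * inverse (h * k) = h * a * inverse h \<longleftrightarrow> k * a = a * k" if "k \<noteq> 0" for k
    proof -
      have "h * k * a * inverse (h * k) = h * (k * a * inverse k) * inverse h"
        using h(1) that by (simp add: nonzero_inverse_mult_distrib mult.assoc)
      also have "\<dots> = h * a * inverse h \<longleftrightarrow> k * a * inverse k = a"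
        using h(1) by simp
      also have "\<dots> \<longleftrightarrow> k * a = a * k"
        using that by (metis nonzero_divide_eq_eq divide_inverse)
      finally show ?thesis .
    qed
    have "{g \<in> - {0}. ?f g = y} = (\<lambda>k. h * k) ` (centralizer a - {0})"
    proof (intro equalityI subsetI)
      fix g assume g: "g \<in> {g \<in> - {0}. ?f g = y}"
      have g_eq: "g = h * (inverse h * g)" using h(1) by (simp add: mult.assoc[symmetric])
      have nz: "inverse h * g \<noteq> 0" using g h(1) by simp
      have "inverse h * g \<in> centralizer a"
        using g h(2) iff[OF nz] g_eq unfolding centralizer_def by simp
      then show "g \<in> (\<lambda>k. h * k) ` (centralizer a - {0})"
        using g_eq nz by blast
    next
      fix g assume "g \<in> (\<lambda>k. h * k) ` (centralizer a - {0})"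
      then obtain k where k: "g = h * k" "k \<noteq> 0" "k * a = a * k"
        unfolding centralizer_def by blast
      then show "g \<in> {g \<in> - {0}. ?f g = y}"
        using h iff[OF k(2)] by simp
    qed
    moreover have "inj_on (\<lambda>k. h * k) (centralizer a - {0})"
      using h(1) by (auto simp: inj_on_def)
    moreover have "0 \<in> centralizer a" by (simp add: centralizer_def)
    ultimately show ?thesis by (simp add: card_image)
  qed
  have "card (- {0 :: 'd}) = (\<Sum>y\<in>conjugates a. card {g \<in> - {0}. ?f g = y})"
    unfolding conjugates_def
    using sum.image_gen[OF finite_subset[OF subset_UNIV fin], of "\<lambda>_. 1 :: nat" "- {0}" ?f] by simp
  also have "\<dots> = card (conjugates a) * (card (centralizer a) - 1)"
    using fibre by simp
  finally show ?thesis by (simp add: Compl_eq_Diff_UNIV card_Diff_subset)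
qed

lemma conjugates_disjoint:
  assumes "conjugates a \<noteq> conjugates b"
  shows "conjugates a \<inter> conjugates b = {}"
proof -
  have sub: "conjugates x \<subseteq> conjugates y" if "g \<noteq> 0" "x = g * y * inverse g" for x y g :: 'a
  proof
    fix z assume "z \<in> conjugates x"
    then obtain h where h: "h \<noteq> 0" "z = h * x * inverse h" unfolding conjugates_def by blast
    then have "z = (h * g) * y * inverse (h * g)"
      using that by (simp add: nonzero_inverse_mult_distrib mult.assoc)
    then show "z \<in> conjugates y"
      using h(1) that(1) unfolding conjugates_def by (intro image_eqI[of _ _ "h * g"]) auto
  qed
  have eq: "conjugates x = conjugates y" if x: "x \<in> conjugates y" for x y :: 'a
  proof -
    obtain g where g: "g \<noteq> 0" "x = g * y * inverse g" using x unfolding conjugates_def by blast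
    have "y = (inverse g * g) * y * (inverse g * g)" using g(1) by simp
    also have "\<dots> = inverse g * x * inverse (inverse g)"
      unfolding g(2) nonzero_inverse_inverse_eq[OF g(1)] by (simp only: mult.assoc)
    finally have "conjugates y \<subseteq> conjugates x"
      using sub[of "inverse g" y x] g(1) by simp
    then show ?thesis using sub[OF g] by blast
  qed
  show ?thesis using assms eq by blast
qed

lemma range_of_center: "range of_center = {c :: 'd::division_ring. \<forall>x. c * x = x * c}"
  using type_definition.Rep_range[OF type_definition_center] .

text \<open>
  Witt's proof of Wedderburn's theorem. Let \<open>q\<close> be the order of the center and \<open>q^n\<close> that of the
  ring, and suppose \<open>n \<ge> 2\<close>. The centralizer of a noncentral element has order \<open>q^d\<close> with
  \<open>0 < d < n\<close>, so the conjugacy class has \<open>(q^n - 1) / (q^d - 1)\<close> elements, and \<open>d\<close> divides \<open>n\<close>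
  since this is an integer. The integer \<open>N\<close> of \<open>cyclotomic_divisor\<close> divides the order of every
  such class, hence the number \<open>q^n - q\<close> of noncentral elements. It also divides \<open>q^n - 1\<close>, so it
  divides \<open>q - 1 > 0\<close>, which is impossible because \<open>\<bar>N\<bar> > q - 1\<close>.
\<close>

theorem finite_division_ring_commute:
  fixes a b :: "'d::division_ring"
  assumes fin: "finite (UNIV :: 'd set)"
  shows "a * b = b * a"
proof -
  let ?q = "card (UNIV :: 'd center set)" and ?Z = "range of_center :: 'd set"
  have q: "2 \<le> ?q" by (rule two_le_card_center[OF fin])
  obtain n where n: "card (UNIV :: 'd set) = ?q ^ n"
    using card_subspace[OF fin center.subspace_UNIV] by blast
  have card_Z: "card ?Z = ?q"
    by (intro card_image) (simp add: inj_def of_center_inject)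
  have finite_sets: "finite S" for S :: "'d set" by (rule finite_subset[OF subset_UNIV fin])
  have "n < 2"
  proof (rule ccontr)
    assume "\<not> n < 2"
    then obtain N where N: "int ?q - 1 < \<bar>N\<bar>" "N dvd int ?q ^ n - 1"
      "\<And>d e. n = d * e \<Longrightarrow> d < n \<Longrightarrow> N dvd (\<Sum>i<e. (int ?q ^ d) ^ i)"
      using cyclotomic_divisor[OF q, of n] by (auto simp: not_less)
    have orbit: "nat \<bar>N\<bar> dvd card (conjugates x)" if "x \<notin> ?Z" for x
    proof -
      obtain d where d: "card (centralizer x) = ?q ^ d"
        using card_subspace[OF fin subspace_centralizer] by blast
      have "centralizer x \<noteq> UNIV"
        using that unfolding range_of_center centralizer_def set_eq_iff by auto metis
      then have "card (centralizer x) < card (UNIV :: 'd set)"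
        by (intro psubset_card_mono fin) auto
      then have "d < n" using d n q by simp
      have "0 < d"
      proof (rule ccontr)
        assume "\<not> 0 < d"
        then have "card (centralizer x) = 1" using d by simp
        moreover have "card {0, 1 :: 'd} \<le> card (centralizer x)"
          by (rule card_mono) (auto simp: centralizer_def finite_sets)
        ultimately show False by simp
      qed
      have prod: "card (conjugates x) * (?q ^ d - 1) = ?q ^ n - 1"
        using card_conjugates[OF fin, of x] d n by simp
      then obtain e where e: "n = d * e"
        using power_minus_1_dvd_imp_dvd[OF q \<open>0 < d\<close>] by (metis dvd_def dvd_triv_right)
      have qd: "1 < ?q ^ d" using q \<open>0 < d\<close> by (intro one_less_power) auto
      have "int (card (conjugates x)) * (int ?q ^ d - 1) = int ?q ^ n - 1"
        using arg_cong[OF prod, of int] q by (simp add: of_nat_diff)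
      also have "\<dots> = (\<Sum>i<e. (int ?q ^ d) ^ i) * (int ?q ^ d - 1)"
        using power_diff_1_eq[of "int ?q ^ d" e] e by (simp add: power_mult mult.commute)
      finally have "int (card (conjugates x)) * (int ?q ^ d - 1)
          = (\<Sum>i<e. (int ?q ^ d) ^ i) * (int ?q ^ d - 1)" .
      moreover have "int ?q ^ d - 1 \<noteq> 0"
        using qd by (metis of_nat_power of_nat_1 of_nat_eq_iff eq_iff_diff_eq_0 less_irrefl)
      ultimately have "int (card (conjugates x)) = (\<Sum>i<e. (int ?q ^ d) ^ i)"
        by (metis mult_right_cancel)
      then have "\<bar>N\<bar> dvd int (card (conjugates x))" using N(3)[OF e \<open>d < n\<close>] by simp
      then show ?thesis by (simp add: nat_abs_dvd_iff)
    qed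
    have noncentral: "\<Union>(conjugates ` (- ?Z)) = - ?Z"
    proof (intro equalityI subsetI)
      fix y assume "y \<in> \<Union>(conjugates ` (- ?Z))"
      then obtain x g where x: "x \<notin> ?Z" "g \<noteq> 0" "y = g * x * inverse g"
        unfolding conjugates_def by blast
      have "x = (inverse g * g) * x * (inverse g * g)" using x(2) by simp
      also have "\<dots> = inverse g * y * g" using x(3) by (simp only: mult.assoc)
      finally have "x = inverse g * y * g" .
      moreover have "inverse g * y * g = y" if "y \<in> ?Z"
      proof -
        have "inverse g * y = y * inverse g"
          using that by (metis imageE of_center_commute)
        then show ?thesis using \<open>g \<noteq> 0\<close> by (simp add: mult.assoc)
      qed
      ultimately show "y \<in> - ?Z" using x(1) by auto
    next
      fix y assume "y \<in> - ?Z"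
      moreover have "y \<in> conjugates y"
        unfolding conjugates_def by (rule image_eqI[of _ _ 1]) auto
      ultimately show "y \<in> \<Union>(conjugates ` (- ?Z))" by blast
    qed
    have "nat \<bar>N\<bar> dvd card (\<Union>(conjugates ` (- ?Z)))"
      using orbit conjugates_disjoint finite_sets by (intro dvd_partition) auto
    also have "\<dots> = ?q ^ n - ?q"
      unfolding noncentral by (simp add: Compl_eq_Diff_UNIV card_Diff_subset finite_sets card_Z n)
    finally have "\<bar>N\<bar> dvd int (?q ^ n - ?q)" by (simp add: nat_abs_dvd_iff)
    moreover have "?q \<le> ?q ^ n"
      using \<open>\<not> n < 2\<close> q by (simp add: self_le_power)
    ultimately have "N dvd int ?q ^ n - int ?q" by (simp add: of_nat_diff)
    then have "N dvd (int ?q ^ n - 1) - (int ?q ^ n - int ?q)" using N(2) by (rule dvd_diff[rotated])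
    then have "N dvd int ?q - 1" by simp
    then have "\<bar>N\<bar> \<le> int ?q - 1" using q dvd_imp_le_int[of "int ?q - 1" N] by simp
    then show False using N(1) by simp
  qed
  (* a dimension below 2 leaves no room outside the center *)
  then have "card (UNIV :: 'd set) \<le> card ?Z"
    using n q card_Z by (cases n) (auto simp: numeral_2_eq_2)
  then have "?Z = UNIV"
    by (intro card_seteq fin) auto
  then have "a \<in> ?Z" by simp
  then show ?thesis unfolding range_of_center by simp
qed

section \<open>Values of formal polynomials\<close>

definition value_at :: "('d::division_ring, 'n) gpoly \<Rightarrow> ('n \<Rightarrow> 'd) \<Rightarrow> 'd" where
  "value_at p = apply_poly_fun (canonical_hom p)"

lemma canonical_hom_simps:
  "canonical_hom 0 = 0" "canonical_hom 1 = 1"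
  "canonical_hom (p + q) = canonical_hom p + canonical_hom q"
  "canonical_hom (p * q) = canonical_hom p * canonical_hom q"
  by (simp_all only: canonical_hom_hom[unfolded unital_ring_hom_def]
      unital_ring_hom_zero[OF canonical_hom_hom])

lemma value_at_const [simp]: "value_at (gp_const a) x = a"
  by (simp add: value_at_def canonical_hom_const pf_const.rep_eq)

lemma value_at_var [simp]: "value_at (gp_var i) x = x i"
  by (simp add: value_at_def canonical_hom_var pf_var.rep_eq)

lemma value_at_add [simp]: "value_at (p + q) x = value_at p x + value_at q x"
  by (simp add: value_at_def canonical_hom_simps plus_poly_fun.rep_eq)

lemma value_at_mult [simp]: "value_at (p * q) x = value_at p x * value_at q x"
  by (simp add: value_at_def canonical_hom_simps times_poly_fun.rep_eq)

lemma value_at_one [simp]: "value_at 1 x = 1"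
  by (simp add: value_at_def canonical_hom_simps one_poly_fun.rep_eq)

lemma value_at_zero [simp]: "value_at 0 x = 0"
  by (simp add: value_at_def canonical_hom_simps zero_poly_fun.rep_eq)

lemma value_at_diff [simp]: "value_at (p - q) x = value_at p x - value_at q x"
  using value_at_add[of "p - q" q x] by (simp del: value_at_add)

lemma value_at_sum [simp]: "value_at (\<Sum>k\<in>K. p k) x = (\<Sum>k\<in>K. value_at (p k) x)"
  by (induction K rule: infinite_finite_induct) simp_all

lemma value_at_power [simp]: "value_at (p ^ l) x = value_at p x ^ l"
  by (induction l) simp_all

lemma GPI_iff: "p \<in> GPI \<longleftrightarrow> (\<forall>x. value_at p x = 0)"
  by (simp add: GPI_def value_at_def apply_poly_fun_inject[symmetric] zero_poly_fun.rep_eq fun_eq_iff)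

lemma two_sided_ideal_GPI: "two_sided_ideal GPI"
  by (simp add: two_sided_ideal_def GPI_iff)

section \<open>Computing modulo an ideal\<close>

lemma two_sided_ideal_generated: "two_sided_ideal (ideal_generated S)"
  unfolding ideal_generated_def
  by (rule hull_in) (auto simp: two_sided_ideal_def)

lemma ideal_generated_minimal: "S \<subseteq> I \<Longrightarrow> two_sided_ideal I \<Longrightarrow> ideal_generated S \<subseteq> I"
  unfolding ideal_generated_def by (rule hull_minimal)

lemma generator_in_ideal: "s \<in> S \<Longrightarrow> s \<in> ideal_generated S"
  unfolding ideal_generated_def by (rule hull_inc)

locale ring_ideal =
  fixes I :: "'r::ring_1 set"
  assumes ideal: "two_sided_ideal I"
begin

lemma zero_mem: "0 \<in> I"
  and add_mem: "a \<in> I \<Longrightarrow> b \<in> I \<Longrightarrow> a + b \<in> I"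
  and left_mult_mem: "a \<in> I \<Longrightarrow> r * a \<in> I"
  and right_mult_mem: "a \<in> I \<Longrightarrow> a * r \<in> I"
  using ideal by (simp_all add: two_sided_ideal_def)

lemma minus_mem: "a \<in> I \<Longrightarrow> - a \<in> I"
  using left_mult_mem[of a "- 1"] by simp

lemma diff_mem: "a \<in> I \<Longrightarrow> b \<in> I \<Longrightarrow> a - b \<in> I"
  using add_mem[of a "- b"] minus_mem by simp

lemma sum_mem: "(\<And>k. k \<in> K \<Longrightarrow> f k \<in> I) \<Longrightarrow> (\<Sum>k\<in>K. f k) \<in> I"
  by (induction K rule: infinite_finite_induct) (simp_all add: zero_mem add_mem)

text \<open>
  \<open>p \<mapsto> p z - z p\<close> is a derivation, so the elements that commute with \<open>z\<close> modulo \<open>I\<close> are closed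
  under products.
\<close>

lemma commute_mod_mult:
  assumes "p * z - z * p \<in> I" "q * z - z * q \<in> I"
  shows "(p * q) * z - z * (p * q) \<in> I"
proof -
  have "(p * q) * z - z * (p * q) = p * (q * z - z * q) + (p * z - z * p) * q"
    by (simp add: algebra_simps)
  then show ?thesis using assms by (simp add: add_mem left_mult_mem right_mult_mem)
qed

lemma commute_mod_sum:
  assumes "\<And>k. k \<in> K \<Longrightarrow> f k * z - z * f k \<in> I"
  shows "(\<Sum>k\<in>K. f k) * z - z * (\<Sum>k\<in>K. f k) \<in> I"
  using sum_mem[of K "\<lambda>k. f k * z - z * f k"] assms
  by (simp add: sum_distrib_left sum_distrib_right sum_subtractf)

end

text \<open>
  The sum of \<open>I\<close> and the left span over the constants of all products of elements of \<open>S\<close>. Closure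
  under left multiplication is demanded for constants and single generators only. If the
  generators are central modulo \<open>I\<close>, the result is still the whole subring generated by \<open>I\<close>, the
  constants and \<open>S\<close>, and inductions never have to expand a product of two sums of monomials.
\<close>

inductive_set polys_in :: "('d::division_ring, 'n) gpoly set \<Rightarrow> ('d, 'n) gpoly set \<Rightarrow> ('d, 'n) gpoly set"
  for I S where
  ideal: "p \<in> I \<Longrightarrow> p \<in> polys_in I S"
| one: "1 \<in> polys_in I S"
| add: "p \<in> polys_in I S \<Longrightarrow> q \<in> polys_in I S \<Longrightarrow> p + q \<in> polys_in I S"
| const: "p \<in> polys_in I S \<Longrightarrow> gp_const a * p \<in> polys_in I S"
| gen: "s \<in> S \<Longrightarrow> p \<in> polys_in I S \<Longrightarrow> s * p \<in> polys_in I S"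

lemma polys_in_sum:
  assumes "two_sided_ideal I" "\<And>k. k \<in> K \<Longrightarrow> f k \<in> polys_in I S"
  shows "(\<Sum>k\<in>K. f k) \<in> polys_in I S"
  using assms
  by (induction K rule: infinite_finite_induct)
     (auto intro: polys_in.intros simp: two_sided_ideal_def)

lemma polys_in_empty:
  assumes "two_sided_ideal I" "p \<in> polys_in I {}"
  obtains a where "p - gp_const a \<in> I"
proof -
  interpret ring_ideal I by unfold_locales (rule assms)
  have hom: "gp_const 0 = (0 :: ('a, 'b) gpoly)" "gp_const 1 = (1 :: ('a, 'b) gpoly)"
    "gp_const (a + c) = (gp_const a + gp_const c :: ('a, 'b) gpoly)"
    "gp_const (a * c) = (gp_const a * gp_const c :: ('a, 'b) gpoly)" for a c
    using gp_const_hom unital_ring_hom_zero[OF gp_const_hom] by (auto simp: unital_ring_hom_def)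
  have "\<exists>a. p - gp_const a \<in> I"
    using assms(2)
  proof induction
    case (ideal p)
    then show ?case using hom(1) by (metis diff_zero)
  next
    case one
    then show ?case using hom(2) zero_mem by (metis diff_self)
  next
    case (add p q)
    then obtain a c where "p - gp_const a \<in> I" "q - gp_const c \<in> I" by blast
    then have "p + q - gp_const (a + c) \<in> I"
      using add_mem[of "p - gp_const a" "q - gp_const c"] by (simp add: hom algebra_simps)
    then show ?case by blast
  next
    case (const p c)
    then obtain a where "p - gp_const a \<in> I" by blast
    then have "gp_const c * p - gp_const (c * a) \<in> I"
      using left_mult_mem[of "p - gp_const a" "gp_const c"] by (simp add: hom right_diff_distrib)
    then show ?case by blast
  qed simp
  then show thesis using that by blast
qed

text \<open>
  Left multiplication by a constant or by an element of \<open>S\<close> acts on the coefficients of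
  \<open>\<Sum> h\<^sub>l z^l\<close>. Left multiplication by \<open>z\<close> shifts them, because \<open>z\<close> is central modulo \<open>I\<close>:
  \<open>z (\<Sum> h\<^sub>l z^l) \<equiv> (\<Sum> h\<^sub>l z^l) z\<close>.
\<close>

lemma polys_in_insert:
  assumes "two_sided_ideal I" and z: "\<And>p. p * z - z * p \<in> I" and "p \<in> polys_in I (insert z S)"
  obtains h k where "\<And>l. h l \<in> polys_in I S" "p - (\<Sum>l<k. h l * z ^ l) \<in> I"
proof -
  interpret ring_ideal I by unfold_locales (rule assms)
  have zero: "0 \<in> polys_in I S" using zero_mem by (rule polys_in.ideal)
  have left: "\<exists>h k. (\<forall>l. h l \<in> polys_in I S) \<and> r * p - (\<Sum>l<k. h l * z ^ l) \<in> I"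
    if p: "\<exists>h k. (\<forall>l. h l \<in> polys_in I S) \<and> p - (\<Sum>l<k. h l * z ^ l) \<in> I"
      and r: "\<And>h. h \<in> polys_in I S \<Longrightarrow> r * h \<in> polys_in I S" for p r
  proof -
    obtain h k where h: "\<forall>l. h l \<in> polys_in I S" "p - (\<Sum>l<k. h l * z ^ l) \<in> I"
      using p by blast
    then have "r * p - (\<Sum>l<k. (r * h l) * z ^ l) \<in> I"
      using left_mult_mem[OF h(2), of r] by (simp add: right_diff_distrib sum_distrib_left mult.assoc)
    then show ?thesis using h(1) r by (intro exI[of _ "\<lambda>l. r * h l"] exI[of _ k]) simp
  qed
  have "\<exists>h k. (\<forall>l. h l \<in> polys_in I S) \<and> p - (\<Sum>l<k. h l * z ^ l) \<in> I"
    using assms(3)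
  proof induction
    case (ideal p)
    then show ?case using zero by (intro exI[of _ "\<lambda>_. 0"] exI[of _ 0]) simp
  next
    case one
    show ?case
      using zero_mem by (intro exI[of _ "\<lambda>_. 1"] exI[of _ 1]) (simp add: polys_in.one)
  next
    case (add p q)
    then obtain h k h' k' where h: "\<forall>l. h l \<in> polys_in I S" "p - (\<Sum>l<k. h l * z ^ l) \<in> I"
      and h': "\<forall>l. h' l \<in> polys_in I S" "q - (\<Sum>l<k'. h' l * z ^ l) \<in> I"
      by blast
    (* the coefficients beyond the old degree bounds have to be cut off before adding *)
    define g where "g l = (if l < k then h l else 0) + (if l < k' then h' l else 0)" for l
    have pad: "(\<Sum>l<max k k'. (if l < j then f l else 0) * z ^ l) = (\<Sum>l<j. f l * z ^ l)"
      if "j \<le> max k k'" for f :: "nat \<Rightarrow> ('a, 'b) gpoly" and j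
      using that by (intro sum.mono_neutral_cong_right) auto
    have "(\<Sum>l<max k k'. g l * z ^ l) = (\<Sum>l<k. h l * z ^ l) + (\<Sum>l<k'. h' l * z ^ l)"
      by (simp add: g_def ring_class.ring_distribs sum.distrib pad)
    then have "p + q - (\<Sum>l<max k k'. g l * z ^ l) \<in> I"
      using add_mem[OF h(2) h'(2)] by (simp add: algebra_simps)
    moreover have "\<forall>l. g l \<in> polys_in I S"
      using h(1) h'(1) zero by (auto simp: g_def intro: polys_in.add)
    ultimately show ?case by blast
  next
    case (const p a)
    show ?case by (rule left[OF const.IH]) (rule polys_in.const)
  next
    case (gen s p)
    show ?case
    proof (cases "s = z")
      case False
      then show ?thesis using gen by (intro left) (auto intro: polys_in.gen)
    next
      case True
      obtain h k where h: "\<forall>l. h l \<in> polys_in I S" "p - (\<Sum>l<k. h l * z ^ l) \<in> I"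
        using gen.IH by blast
      define g where "g l = (case l of 0 \<Rightarrow> 0 | Suc l' \<Rightarrow> h l')" for l
      have "(\<Sum>l<Suc k. g l * z ^ l) = (\<Sum>l<k. h l * z ^ l) * z"
        by (simp add: sum.lessThan_Suc_shift g_def sum_distrib_right mult.assoc power_Suc2 del: power_Suc sum.lessThan_Suc)
      then have "z * p - (\<Sum>l<Suc k. g l * z ^ l) = (p - (\<Sum>l<k. h l * z ^ l)) * z - (p * z - z * p)"
        by (simp add: algebra_simps)
      also have "\<dots> \<in> I"
        by (rule diff_mem[OF right_mult_mem[OF h(2)] z])
      finally have "s * p - (\<Sum>l<Suc k. g l * z ^ l) \<in> I" using True by simp
      moreover have "\<forall>l. g l \<in> polys_in I S"
        using h(1) zero by (auto simp: g_def split: nat.split)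
      ultimately show ?thesis by blast
    qed
  qed
  then show thesis using that by blast
qed

section \<open>Coordinates with respect to a basis over the center\<close>

text \<open>
  A finite center would make the whole ring finite, hence commutative.
\<close>

lemma infinite_center:
  fixes a b :: "'d::division_ring"
  assumes B: "finite B" "center.span B = (UNIV :: 'd set)" and "a * b \<noteq> b * a"
  shows "infinite (UNIV :: 'd center set)"
proof
  assume fin: "finite (UNIV :: 'd center set)"
  have "finite (range (\<lambda>u. \<Sum>v\<in>B. center_scale (u v) v))"
  proof (rule finite_subset)
    (* a combination only depends on the values of u on the finite set B *)
    show "range (\<lambda>u. \<Sum>v\<in>B. center_scale (u v) v)
        \<subseteq> (\<lambda>u. \<Sum>v\<in>B. center_scale (u v) v) ` (B \<rightarrow>\<^sub>E UNIV)"
    proof clarify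
      fix u :: "'d \<Rightarrow> 'd center"
      have "(\<Sum>v\<in>B. center_scale (u v) v) = (\<Sum>v\<in>B. center_scale (restrict u B v) v)"
        by (rule sum.cong) auto
      then show "(\<Sum>v\<in>B. center_scale (u v) v)
          \<in> (\<lambda>u. \<Sum>v\<in>B. center_scale (u v) v) ` (B \<rightarrow>\<^sub>E UNIV)"
        by (rule image_eqI[where x = "restrict u B"]) simp
    qed
  qed (intro finite_imageI finite_PiE B(1) fin)
  then have "finite (UNIV :: 'd set)"
    using center.span_finite[OF B(1)] B(2) by simp
  then show False using finite_division_ring_commute assms(3) by blast
qed

locale coordinate_formula =
  fixes v :: "nat \<Rightarrow> 'd::division_ring" and m :: nat and b :: "nat \<Rightarrow> nat \<Rightarrow> nat \<Rightarrow> 'd center"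
  assumes m: "m > 1"
    and inj: "inj_on v {1..m}"
    and independent: "center.independent (v ` {1..m})"
    and span: "center.span (v ` {1..m}) = UNIV"
    and formula: "\<And>(x :: 'd) (c :: nat \<Rightarrow> 'd center) j.
           x = (\<Sum>k=1..m. of_center (c k) * v k) \<Longrightarrow> j \<in> {1..m} \<Longrightarrow>
           of_center (c j) = (\<Sum>s=1..m. \<Sum>t=1..m. of_center (b j s t) * v s * x * v t)"
begin

(* keeps the intervals {1..m} in the form in which the facts below mention them *)
declare One_nat_def [simp del]

text \<open>
  In a commutative division ring the center is everything, and the two basis vectors \<open>v\<^sub>1\<close> and \<open>v\<^sub>2\<close>
  would be dependent over it.
\<close>

lemma noncommuting: "\<exists>a c :: 'd. a * c \<noteq> c * a"
proof (rule ccontr)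
  assume comm: "\<nexists>a c :: 'd. a * c \<noteq> c * a"
  have "v 1 \<noteq> v 2" using inj_onD[OF inj, of 1 2] m by auto
  have "v 2 \<noteq> 0"
    using independent m center.dependent_zero[of "v ` {1..m}"] by force
  have "v 1 / v 2 \<in> range of_center" unfolding range_of_center using comm by blast
  then obtain c where c: "v 1 / v 2 = of_center c" by auto
  then have "v 1 = center_scale c (v 2)"
    using \<open>v 2 \<noteq> 0\<close> by (simp add: center_scale_def divide_inverse mult.assoc flip: c)
  moreover have "v 2 \<in> v ` {1..m} - {v 1}"
    using m \<open>v 1 \<noteq> v 2\<close> by auto
  ultimately have "v 1 \<in> center.span (v ` {1..m} - {v 1})"
    by (simp only: center.span_scale center.span_base)
  moreover have "v 1 \<in> v ` {1..m}" using m by auto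
  ultimately show False
    using independent unfolding center.dependent_def by blast
qed

lemma infinite_scalars: "infinite (UNIV :: 'd center set)"
  using infinite_center[of "v ` {1..m}"] span noncommuting by auto

lemma expansion: "\<exists>c. x = (\<Sum>k=1..m. of_center (c k) * v k)"
proof -
  have "x \<in> center.span (v ` {1..m})" using span by simp
  then obtain u where "x = (\<Sum>w\<in>v ` {1..m}. center_scale (u w) w)"
    by (auto simp: center.span_finite)
  then show ?thesis
    by (intro exI[of _ "\<lambda>k. u (v k)"]) (simp add: sum.reindex[OF inj] center_scale_def)
qed

text \<open>
  The values at indices outside \<open>{1..m}\<close> are arbitrary, so the facts about coordinates restrict \<open>j\<close>.
\<close>

definition coord :: "'d \<Rightarrow> nat \<Rightarrow> 'd center" where
  "coord x = (SOME c. x = (\<Sum>k=1..m. of_center (c k) * v k))"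

lemma sum_coord: "(\<Sum>k=1..m. of_center (coord x k) * v k) = x"
  unfolding coord_def by (rule someI_ex[OF expansion, symmetric])

lemma coord_formula:
  "j \<in> {1..m} \<Longrightarrow>
    of_center (coord x j) = (\<Sum>s=1..m. \<Sum>t=1..m. of_center (b j s t) * v s * x * v t)"
  by (rule formula[OF sum_coord[symmetric]])

lemma coord_unique:
  assumes "x = (\<Sum>k=1..m. of_center (c k) * v k)" "j \<in> {1..m}"
  shows "coord x j = c j"
  using formula[OF assms] coord_formula[OF assms(2)] by (simp flip: of_center_inject)

lemma coord_zero: "j \<in> {1..m} \<Longrightarrow> coord 0 j = 0"
  by (rule coord_unique) (simp_all add: zero_center.rep_eq)

lemma coord_add: "j \<in> {1..m} \<Longrightarrow> coord (x + y) j = coord x j + coord y j"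
  by (rule coord_unique)
     (simp_all add: plus_center.rep_eq ring_class.ring_distribs sum.distrib sum_coord)

lemma coord_scale: "j \<in> {1..m} \<Longrightarrow> coord (x * of_center c) j = coord x j * c"
proof (rule coord_unique)
  have "(\<Sum>k=1..m. of_center (coord x k * c) * v k) = (\<Sum>k=1..m. of_center (coord x k) * v k) * of_center c"
    by (simp add: sum_distrib_right times_center.rep_eq mult.assoc of_center_commute[of c])
  then show "x * of_center c = (\<Sum>k=1..m. of_center (coord x k * c) * v k)"
    by (simp add: sum_coord)
qed

lemma coord_sum: "j \<in> {1..m} \<Longrightarrow> coord (\<Sum>l\<in>K. f l) j = (\<Sum>l\<in>K. coord (f l) j)"
  by (induction K rule: infinite_finite_induct) (simp_all add: coord_zero coord_add)

lemma of_center_power: "of_center (c ^ l) = of_center c ^ l"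
  by (induction l) (simp_all add: one_center.rep_eq times_center.rep_eq)

text \<open>
  Taking coordinates turns a polynomial with coefficients in the division ring and a central
  argument into \<open>m\<close> ordinary polynomials over the center, which vanish on an infinite field. This
  is where infinitely many scalars are indispensable.
\<close>

lemma coefficients_zero:
  fixes a :: "nat \<Rightarrow> 'd"
  assumes vanish: "\<And>c. (\<Sum>l<k. a l * of_center c ^ l) = 0" and "l < k"
  shows "a l = 0"
proof -
  have "coord (a l) j = 0" if j: "j \<in> {1..m}" for j
  proof -
    define f where "f = (\<Sum>i<k. monom (coord (a i) j) i)"
    have "poly f c = 0" for c
    proof -
      have "poly f c = coord (\<Sum>i<k. a i * of_center c ^ i) j"
        using j by (simp add: f_def poly_sum poly_monom coord_sum coord_scale flip: of_center_power)
      then show ?thesis using vanish j by (simp add: coord_zero)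
    qed
    then have "f = 0"
      using poly_roots_finite[of f] infinite_scalars by auto
    then have "coeff f l = 0" by simp
    moreover have "coeff f l = coord (a l) j"
      using \<open>l < k\<close> by (simp add: f_def coeff_sum)
    ultimately show ?thesis by simp
  qed
  then have "(\<Sum>j=1..m. of_center (coord (a l) j) * v j) = 0"
    by (intro sum.neutral) (simp add: zero_center.rep_eq)
  then show ?thesis by (simp only: sum_coord)
qed

section \<open>The relations and their ideal\<close>

definition Y :: "'n \<Rightarrow> nat \<Rightarrow> ('d, 'n) gpoly" where
  "Y i j = (\<Sum>s=1..m. \<Sum>t=1..m.
           gp_const (of_center (b j s t)) * gp_const (v s) * gp_var i * gp_const (v t))"

lemma value_at_Y: "j \<in> {1..m} \<Longrightarrow> value_at (Y i j) x = of_center (coord (x i) j)"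
  by (simp add: Y_def coord_formula)

definition relations :: "('d, 'n) gpoly set" where
  "relations =
    {gp_const (v k) * Y i j - Y i j * gp_const (v k) | i j k. j \<in> {1..m} \<and> k \<in> {1..m}} \<union>
    {Y i j * Y i' j' - Y i' j' * Y i j | i i' j j'. j \<in> {1..m} \<and> j' \<in> {1..m}} \<union>
    {gp_var i - (\<Sum>j=1..m. Y i j * gp_const (v j)) | i. True}"

lemma relations_subset_GPI: "(relations :: ('d, 'n) gpoly set) \<subseteq> GPI"
proof -
  have r1: "gp_const (v k) * Y i j - Y i j * gp_const (v k) \<in> GPI" if "j \<in> {1..m}" for i :: 'n and j k
    using that by (auto simp: GPI_iff value_at_Y intro: of_center_commute of_center_commute[symmetric])
  have r2: "Y i j * Y i' j' - Y i' j' * Y i j \<in> GPI" if "j \<in> {1..m}" "j' \<in> {1..m}" for i i' :: 'n and j j'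
    using that by (auto simp: GPI_iff value_at_Y intro: of_center_commute of_center_commute[symmetric])
  have r3: "gp_var i - (\<Sum>j=1..m. Y i j * gp_const (v j)) \<in> GPI" for i :: 'n
    using sum_coord by (simp add: GPI_iff value_at_Y)
  show ?thesis
    unfolding relations_def by (intro Un_least subsetI; elim CollectE exE conjE; simp only: r1 r2 r3)
qed

abbreviation J :: "('d, 'n) gpoly set" where "J \<equiv> ideal_generated relations"

sublocale J: ring_ideal "J :: ('d, 'n) gpoly set"
  by unfold_locales (rule two_sided_ideal_generated)

lemma Y_commute_basis:
  "j \<in> {1..m} \<Longrightarrow> k \<in> {1..m} \<Longrightarrow> gp_const (v k) * Y i j - Y i j * gp_const (v k) \<in> J"
  by (rule generator_in_ideal) (unfold relations_def, blast)

lemma Y_commute: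
  "j \<in> {1..m} \<Longrightarrow> j' \<in> {1..m} \<Longrightarrow> Y i j * Y i' j' - Y i' j' * Y i j \<in> J"
  by (rule generator_in_ideal) (unfold relations_def, blast)

lemma var_expansion: "gp_var i - (\<Sum>j=1..m. Y i j * gp_const (v j)) \<in> J"
  by (rule generator_in_ideal) (unfold relations_def, blast)

text \<open>
  The generators of the ideal only make the \<open>Y i j\<close> commute with the basis elements and with one
  another. Constants are combinations of the basis elements with central coefficients, and by
  the third kind of relation every variable is a combination of products \<open>Y i j v\<^sub>j\<close>, so the
  \<open>Y i j\<close> commute, modulo the ideal, with a generating set of the whole algebra.
\<close>

lemma Y_central:
  fixes p :: "('d, 'n) gpoly"
  assumes j: "j \<in> {1..m}"
  shows "p * Y i j - Y i j * p \<in> J"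
proof (induction p rule: gpoly_induct)
  case (const a)
  have const_sum: "gp_const (\<Sum>k\<in>K. f k) = (\<Sum>k\<in>K. gp_const (f k) :: ('d, 'n) gpoly)"
    for K and f :: "nat \<Rightarrow> 'd"
    using gp_const_hom[where 'd = 'd and 'n = 'n] unital_ring_hom_zero[OF gp_const_hom[where 'd = 'd and 'n = 'n]]
    by (induction K rule: infinite_finite_induct) (auto simp: unital_ring_hom_def)
  have "(\<Sum>k=1..m. gp_const (of_center (coord a k)) * gp_const (v k)) * Y i j
      - Y i j * (\<Sum>k=1..m. gp_const (of_center (coord a k)) * gp_const (v k)) \<in> J"
    by (intro J.commute_mod_sum J.commute_mod_mult Y_commute_basis j)
       (simp_all add: gp_const_central J.zero_mem)
  also have "(\<Sum>k=1..m. gp_const (of_center (coord a k)) * gp_const (v k)) = (gp_const a :: ('d, 'n) gpoly)"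
  proof -
    have "(\<Sum>k=1..m. gp_const (of_center (coord a k)) * gp_const (v k))
        = (gp_const (\<Sum>k=1..m. of_center (coord a k) * v k) :: ('d, 'n) gpoly)"
      using gp_const_hom[where 'd = 'd and 'n = 'n] by (simp add: const_sum unital_ring_hom_def)
    then show ?thesis by (simp only: sum_coord)
  qed
  finally show ?case .
next
  case (var i')
  let ?s = "\<Sum>k=1..m. Y i' k * gp_const (v k)"
  have "?s * Y i j - Y i j * ?s \<in> J"
    by (intro J.commute_mod_sum J.commute_mod_mult Y_commute Y_commute_basis j)
  moreover have "(gp_var i' - ?s) * Y i j - Y i j * (gp_var i' - ?s) \<in> J"
    by (intro J.diff_mem J.left_mult_mem J.right_mult_mem var_expansion)
  ultimately have "(?s * Y i j - Y i j * ?s) + ((gp_var i' - ?s) * Y i j - Y i j * (gp_var i' - ?s)) \<in> J"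
    by (rule J.add_mem)
  then show ?case by (simp add: left_diff_distrib right_diff_distrib)
next
  case (plus p q)
  then have "(p * Y i j - Y i j * p) + (q * Y i j - Y i j * q) \<in> J" by (rule J.add_mem)
  then show ?case by (simp add: algebra_simps)
next
  case (uminus p)
  then have "- (p * Y i j - Y i j * p) \<in> J" by (rule J.minus_mem)
  then show ?case by (simp add: algebra_simps)
next
  case (times p q)
  then show ?case by (rule J.commute_mod_mult)
qed

section \<open>Vanishing polynomials lie in the ideal\<close>

definition Ys :: "('n \<times> nat) set \<Rightarrow> ('d, 'n) gpoly set" where
  "Ys T = (\<lambda>(i, j). Y i j) ` T"

text \<open>
  The set on the right is closed under left multiplication by every formal polynomial: for a
  variable, replace it by its expansion in the \<open>Y i j\<close>. It contains \<open>1\<close>, so it is everything.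
\<close>

lemma all_polys: "(p :: ('d, 'n) gpoly) \<in> polys_in J (Ys (UNIV \<times> {1..m}))"
proof -
  let ?M = "polys_in J (Ys (UNIV \<times> {1..m})) :: ('d, 'n) gpoly set"
  have "\<forall>q\<in>?M. p * q \<in> ?M"
  proof (induction p rule: gpoly_induct)
    case (const a)
    show ?case by (auto intro: polys_in.const)
  next
    case (var i)
    show ?case
    proof
      fix q assume q: "q \<in> ?M"
      have "(gp_var i - (\<Sum>j=1..m. Y i j * gp_const (v j))) * q \<in> ?M"
        by (intro polys_in.ideal J.right_mult_mem var_expansion)
      moreover have "(\<Sum>j=1..m. Y i j * (gp_const (v j) * q)) \<in> ?M"
        using q by (intro polys_in_sum J.ideal polys_in.gen polys_in.const) (auto simp: Ys_def)
      ultimately have "(gp_var i - (\<Sum>j=1..m. Y i j * gp_const (v j))) * q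
          + (\<Sum>j=1..m. Y i j * (gp_const (v j) * q)) \<in> ?M"
        by (rule polys_in.add)
      then show "gp_var i * q \<in> ?M"
        by (simp add: left_diff_distrib sum_distrib_right mult.assoc)
    qed
  next
    case (plus p q)
    then show ?case by (simp add: algebra_simps polys_in.add)
  next
    case (uminus p)
    show ?case
    proof
      fix q assume "q \<in> ?M"
      then have "gp_const (- 1) * (p * q) \<in> ?M" using uminus by (auto intro: polys_in.const)
      moreover have "gp_const (- 1) = (- 1 :: ('d, 'n) gpoly)"
        using unital_ring_hom_uminus[OF gp_const_hom, of 1] gp_const_hom
        by (metis unital_ring_hom_def)
      ultimately show "- p * q \<in> ?M" by simp
    qed
  next
    case (times p q)
    then show ?case by (simp add: mult.assoc)
  qed
  then show ?thesis using polys_in.one by (metis mult_1_right)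
qed

lemma J_subset_GPI: "J \<subseteq> GPI"
  by (intro ideal_generated_minimal relations_subset_GPI two_sided_ideal_GPI)

text \<open>
  As a function, \<open>Y i j\<close> is the \<open>j\<close>-th coordinate of the \<open>i\<close>-th argument; a polynomial in some of
  the \<open>Y i j\<close> depends on the corresponding coordinates only.
\<close>

lemma value_at_cong:
  assumes "p \<in> polys_in J (Ys T)" "T \<subseteq> UNIV \<times> {1..m}"
    and "\<And>i j. (i, j) \<in> T \<Longrightarrow> coord (x i) j = coord (y i) j"
  shows "value_at p x = value_at p y"
  using assms(1)
proof induction
  case (ideal p)
  then show ?case using J_subset_GPI by (auto simp: GPI_iff)
next
  case (gen s p)
  then obtain i j where "s = Y i j" "(i, j) \<in> T" by (auto simp: Ys_def)
  then show ?case using gen assms(2,3) by (auto simp: value_at_Y)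
qed simp_all

text \<open>
  With this choice of a new argument, one of the \<open>Y i j\<close> runs through \<open>F\<close> while the values of
  the others are kept.
\<close>

lemma coord_update:
  fixes x :: 'd
  assumes "j \<in> {1..m}" "j' \<in> {1..m}"
  shows "coord (x + of_center (t - coord x j) * v j) j' = (if j' = j then t else coord x j')"
proof (rule coord_unique[OF _ assms(2)])
  have "(\<Sum>k=1..m. of_center (if k = j then t else coord x k) * v k)
      = (\<Sum>k=1..m. of_center (coord x k) * v k + (if k = j then of_center (t - coord x j) * v j else 0))"
    by (rule sum.cong) (auto simp: minus_center.rep_eq algebra_simps)
  also have "\<dots> = x + of_center (t - coord x j) * v j"
    using assms(1) by (simp add: sum.distrib sum_coord)
  finally show "x + of_center (t - coord x j) * v j
      = (\<Sum>k=1..m. of_center (if k = j then t else coord x k) * v k)" ..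
qed

text \<open>
  The induction is over the set of coordinates on which \<open>p\<close> depends. Collect \<open>p\<close> by powers of one
  of the \<open>Y i j\<close>. Fix all other coordinates and let the \<open>(i, j)\<close>-th one run through the infinite
  field \<open>F\<close>: the values of the coefficients stay fixed, so \<open>coefficients_zero\<close> makes them zero.
  Hence the coefficients are vanishing polynomials in fewer of the \<open>Y i j\<close> and belong to the
  ideal by induction.
\<close>

lemma vanishing_in_ideal:
  assumes "finite T" "T \<subseteq> UNIV \<times> {1..m}"
    and "p \<in> polys_in J (Ys T)" "\<And>x. value_at p x = 0"
  shows "p \<in> J"
  using assms
proof (induction T arbitrary: p)
  case empty
  then obtain a where a: "p - gp_const a \<in> J"
    using polys_in_empty[OF J.ideal] by (auto simp: Ys_def)
  then have "value_at (p - gp_const a) (\<lambda>_. 0) = 0"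
    using J_subset_GPI GPI_iff by blast
  then have "a = 0" using empty.prems by simp
  then show ?case using a unital_ring_hom_zero[OF gp_const_hom] by (metis diff_zero)
next
  case (insert ij T)
  obtain i j where ij: "ij = (i, j)" by fastforce
  have j: "j \<in> {1..m}" using insert.prems ij by auto
  have p_mem: "p \<in> polys_in J (insert (Y i j) (Ys T))"
    using insert.prems(2) by (simp add: Ys_def ij)
  obtain h k where h: "\<And>l. h l \<in> polys_in J (Ys T)"
    and p: "p - (\<Sum>l<k. h l * Y i j ^ l) \<in> J"
    by (rule polys_in_insert[OF J.ideal Y_central[OF j] p_mem]) (rule that)
  have vanish: "(\<Sum>l<k. value_at (h l) x * of_center (coord (x i) j) ^ l) = 0" for x
  proof -
    have "value_at (p - (\<Sum>l<k. h l * Y i j ^ l)) x = 0"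
      using p J_subset_GPI GPI_iff by blast
    then show ?thesis using insert.prems(3) by (simp add: value_at_Y[OF j])
  qed
  have "h l \<in> J" if "l < k" for l
  proof (rule insert.IH[OF _ h])
    show "T \<subseteq> UNIV \<times> {1..m}" using insert.prems by simp
    fix x
    have "(\<Sum>l<k. value_at (h l) x * of_center t ^ l) = 0" for t
    proof -
      (* the point that differs from x in the (i, j)-th coordinate only, which is t *)
      let ?x = "x(i := x i + of_center (t - coord (x i) j) * v j)"
      have "value_at (h l) ?x = value_at (h l) x" for l
        using insert.hyps insert.prems(1) ij j
        by (intro value_at_cong[OF h]) (auto simp: coord_update)
      then show ?thesis using vanish[of ?x] j by (simp add: coord_update)
    qed
    then show "value_at (h l) x = 0" using that by (rule coefficients_zero)
  qed
  then have "(\<Sum>l<k. h l * Y i j ^ l) \<in> J"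
    by (intro J.sum_mem J.right_mult_mem) auto
  from J.add_mem[OF p this] show ?case by simp
qed

lemma GPI_eq: "(GPI :: ('d, 'n::finite) gpoly set) = J"
proof
  show "(GPI :: ('d, 'n) gpoly set) \<subseteq> J"
  proof
    fix p :: "('d, 'n) gpoly" assume "p \<in> GPI"
    then show "p \<in> J"
      by (intro vanishing_in_ideal[OF _ _ all_polys]) (simp_all add: GPI_iff)
  qed
qed (rule J_subset_GPI)

end

theorem theorem6:
  fixes v :: "nat \<Rightarrow> 'd::division_ring"
    and m :: nat
    and b :: "nat \<Rightarrow> nat \<Rightarrow> nat \<Rightarrow> 'd center"
    and Y :: "'n::finite \<Rightarrow> nat \<Rightarrow> ('d, 'n) gpoly"
  assumes "m > 1"
    and "inj_on v {1..m}"
    and "center.independent (v ` {1..m})"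
    and "center.span (v ` {1..m}) = UNIV"
    and "\<And>(x :: 'd) (c :: nat \<Rightarrow> 'd center) j.
           x = (\<Sum>k=1..m. of_center (c k) * v k) \<Longrightarrow> j \<in> {1..m} \<Longrightarrow>
           of_center (c j) = (\<Sum>s=1..m. \<Sum>t=1..m. of_center (b j s t) * v s * x * v t)"
  defines "Y \<equiv> \<lambda>i j. \<Sum>s=1..m. \<Sum>t=1..m.
           gp_const (of_center (b j s t)) * gp_const (v s) * gp_var i * gp_const (v t)"
  shows "(GPI :: ('d, 'n) gpoly set) = ideal_generated
    ({gp_const (v k) * Y i j - Y i j * gp_const (v k) | i j k. j \<in> {1..m} \<and> k \<in> {1..m}} \<union>
     {Y i j * Y i' j' - Y i' j' * Y i j | i i' j j'. j \<in> {1..m} \<and> j' \<in> {1..m}} \<union>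
     {gp_var i - (\<Sum>j=1..m. Y i j * gp_const (v j)) | i. True})"
proof -
  interpret F: coordinate_formula v m b
    by unfold_locales (fact assms)+
  have "Y = F.Y" by (simp add: Y_def F.Y_def fun_eq_iff)
  then show ?thesis using F.GPI_eq unfolding F.relations_def by simp
qed

end
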